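(* As $n\to\infty$, $$\mathrm{ex}_{3}(n,K_{2,2,7}^{(3)})\geqslant \frac{1}{27}n^{\frac{19}{7}}+o\left(n^{\frac{19}{7}}\right).$$
   Context: A $3$-graph is a $3$-uniform hypergraph. For a $3$-graph $\mathcal{H}$, $\mathrm{ex}_{3}(n,\mathcal{H})$ is the maximum number of edges in an $n$-vertex $3$-graph containing no copy of $\mathcal{H}$ as a (not necessarily induced) subhypergraph. $K_{2,2,7}^{(3)}$ denotes the complete $3$-partite $3$-graph with parts of sizes $2,2,7$: its vertex set is the disjoint union of sets $V_1,V_2,V_3$ with $|V_1|=|V_2|=2$, $|V_3|=7$, and its edges are all triples $\{x_1,x_2,x_3\}$ with $x_i\in V_i$ for $i=1,2,3$. *)

theory Defs
  imports Complex_Main "HOL-Library.Landau_Symbols"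
begin

type_synonym 'a hypergraph = "'a set \<times> 'a set set"

definition verts :: "'a hypergraph \<Rightarrow> 'a set" where
  "verts H = fst H"

definition edges :: "'a hypergraph \<Rightarrow> 'a set set" where
  "edges H = snd H"

definition three_graph :: "'a hypergraph \<Rightarrow> bool" where
  "three_graph H \<longleftrightarrow> finite (verts H) \<and> (\<forall>e\<in>edges H. e \<subseteq> verts H \<and> card e = 3)"

text \<open>Copies are not required to be induced: only edges have to be preserved.\<close>

definition contains_copy :: "'a hypergraph \<Rightarrow> 'b hypergraph \<Rightarrow> bool" where
  "contains_copy G H \<longleftrightarrow>
     (\<exists>f. inj_on f (verts H) \<and> f ` verts H \<subseteq> verts G \<and> (\<forall>e\<in>edges H. f ` e \<in> edges G))"

text \<open>
  Up to isomorphism, an n-vertex 3-graph has vertex set \<open>{..<n}\<close>. The set under \<open>Max\<close> is always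
  finite; it is nonempty whenever \<open>H\<close> has at least one edge, since the empty 3-graph qualifies.
\<close>

definition ex3 :: "nat \<Rightarrow> 'b hypergraph \<Rightarrow> nat" where
  "ex3 n H = Max {card (edges G) | G :: nat hypergraph.
     three_graph G \<and> verts G = {..<n} \<and> \<not> contains_copy G H}"

text \<open>
  The complete 3-partite 3-graph with parts of sizes \<open>r\<close>, \<open>s\<close>, \<open>t\<close>; the first component of a
  vertex is the index of its part, which makes the parts disjoint.
\<close>

definition complete_tripartite :: "nat \<Rightarrow> nat \<Rightarrow> nat \<Rightarrow> (nat \<times> nat) hypergraph" where
  "complete_tripartite r s t =
     (let V1 = {1} \<times> {..<r}; V2 = {2} \<times> {..<s}; V3 = {3} \<times> {..<t}
      in (V1 \<union> V2 \<union> V3, {{x1, x2, x3} | x1 x2 x3. x1 \<in> V1 \<and> x2 \<in> V2 \<and> x3 \<in> V3}))"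

end

theory Submission
  imports Defs "HOL-Algebra.Algebraic_Closure_Type" "Berlekamp_Zassenhaus.Finite_Field"
    "HOL-Real_Asymp.Real_Asymp"
begin

hide_const (open) Divisibility.prime

text \<open>
  The construction is a 3-uniform version of the projective norm graph. Let \<open>q = p ^ m\<close>, let
  \<open>\<beta>\<close> map the integer box \<open>{1..M} ^ (3 * m)\<close> injectively into the field with \<open>q ^ 3\<close> elements via
  a basis over the prime field, and let a vertex consist of a colour, a box point \<open>u\<close> and a nonzero
  element \<open>a\<close> of the field with \<open>q\<close> elements. Three vertices of different colours form an edge if
  \<open>N (\<beta> u + \<beta> v + \<beta> w) = a * b * c\<close>, where \<open>N\<close> is the norm, and moreover
  \<open>u \<bullet> v + u \<bullet> w + v \<bullet> w = r\<close>, where \<open>r\<close> is chosen by pigeonhole.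

  In a copy of \<open>K\<^sub>2\<^sub>,\<^sub>2\<^sub>,\<^sub>7\<close> the four sums \<open>A\<^sub>i\<^sub>j = \<beta> u\<^sub>i + \<beta> v\<^sub>j\<close> are distinct: if \<open>A\<^sub>1\<^sub>1 = A\<^sub>2\<^sub>2\<close>, the
  alternating sum of the inner product condition gives \<open>|u\<^sub>1 - u\<^sub>2|\<^sup>2 = 0\<close>. Hence the seven vertices
  of the last part solve four equations \<open>N (z + A\<^sub>i\<^sub>j) = \<alpha>\<^sub>i\<^sub>j * c\<close>, which have at most \<open>3! = 6\<close> solutions, as
  for the projective norm graph. The box condition costs a factor exponential in \<open>m\<close>, but with a small
  base compared with \<open>p\<close>, and the pigeonhole a factor linear in \<open>m\<close>; so for suitable fixed \<open>p\<close> and \<open>M\<close>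
  and \<open>m \<rightarrow> \<infinity>\<close> the number of edges exceeds \<open>n\<close> to the power \<open>19 / 7\<close> by a power of \<open>n\<close>. This
  gap also absorbs the passage to general \<open>n\<close>, so that the error term may be taken to be \<open>0\<close>.
\<close>

subsection \<open>Systems of norm equations\<close>

lemma card_three_cubics_le:
  fixes e\<^sub>1 e\<^sub>2 e\<^sub>3 m\<^sub>1 m\<^sub>2 m\<^sub>3 :: "'a :: field"
  assumes e: "e\<^sub>2 \<noteq> 0" "e\<^sub>2 \<noteq> 1" "e\<^sub>3 \<noteq> 0" "e\<^sub>3 \<noteq> 1" and m: "m\<^sub>1 \<noteq> 0"
  defines "T \<equiv> {x. \<exists>y z. x * y * z = m\<^sub>1 \<and> (x - 1) * (y - 1) * (z - 1) = m\<^sub>2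
                   \<and> (x - e\<^sub>1) * (y - e\<^sub>2) * (z - e\<^sub>3) = m\<^sub>3}"
  shows "finite T" and "card T \<le> 6"
proof -
  (* Eliminate y and z: they solve a linear system over the rational functions in x, and
     x * y * z = m1 then leaves an equation of degree 6 in x. No denominator is cancelled, so the
     degenerate cases x = 1, x = e1 and e2 = e3 need no separate treatment. *)
  define k where "k = m\<^sub>1 - 1 - m\<^sub>2"
  define l where "l = m\<^sub>1 - e\<^sub>1 * e\<^sub>2 * e\<^sub>3 - m\<^sub>3"
  define a where "a = [:- m\<^sub>1, k, 1:]"
  define b where "b = [:- e\<^sub>1 * m\<^sub>1, l, e\<^sub>2 * e\<^sub>3:]"
  define p where "p = [:-1, 1:] * b - smult e\<^sub>2 ([:- e\<^sub>1, 1:] * a)"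
  define r where "r = smult e\<^sub>3 ([:- e\<^sub>1, 1:] * a) - [:-1, 1:] * b"
  define f where "f = p * r - smult (m\<^sub>1 * (e\<^sub>3 - e\<^sub>2)\<^sup>2) ([:0, 1:] * [:-1, 1:]\<^sup>2 * [:- e\<^sub>1, 1:]\<^sup>2)"
  have root: "poly f x = 0" if "x \<in> T" for x
  proof -
    from that obtain y z where 1: "x * y * z = m\<^sub>1" and 2: "(x - 1) * (y - 1) * (z - 1) = m\<^sub>2"
      and 3: "(x - e\<^sub>1) * (y - e\<^sub>2) * (z - e\<^sub>3) = m\<^sub>3"
      by (auto simp: T_def)
    \<comment> \<open>Multiplying the second or third equation by \<open>x\<close> and replacing
      \<open>x * y * z\<close> by \<open>m\<^sub>1\<close> leaves an equation linear in
      \<open>y\<close> and \<open>z\<close>.\<close>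
    have a: "x * (x - 1) * (y + z) = poly a x"
      unfolding a_def k_def 1[symmetric] 2[symmetric] by (simp add: algebra_simps)
    have b: "x * (x - e\<^sub>1) * (e\<^sub>3 * y + e\<^sub>2 * z) = poly b x"
      unfolding b_def l_def 1[symmetric] 3[symmetric] by (simp add: algebra_simps)
    have p: "poly p x = x * (x - 1) * (x - e\<^sub>1) * (e\<^sub>3 - e\<^sub>2) * y"
      unfolding p_def poly_diff poly_mult poly_smult a[symmetric] b[symmetric]
      by (simp add: algebra_simps)
    have r: "poly r x = x * (x - 1) * (x - e\<^sub>1) * (e\<^sub>3 - e\<^sub>2) * z"
      unfolding r_def poly_diff poly_mult poly_smult a[symmetric] b[symmetric]
      by (simp add: algebra_simps)
    show ?thesis
      unfolding f_def poly_diff poly_mult poly_smult p r 1[symmetric]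
      by (simp add: algebra_simps power2_eq_square)
  qed
  \<comment> \<open>Only \<open>p * r\<close> reaches degree 6: the cubic coefficients of
    \<open>p\<close> and \<open>r\<close> are \<open>e\<^sub>2 * (e\<^sub>3 - 1)\<close> and
    \<open>e\<^sub>3 * (1 - e\<^sub>2)\<close>, while the subtracted term has degree at most
    5.\<close>
  have "coeff f 6 = e\<^sub>2 * e\<^sub>3 * (e\<^sub>3 - 1) * (1 - e\<^sub>2)"
    unfolding f_def p_def r_def a_def b_def
    by (simp add: coeff_pCons eval_nat_numeral algebra_simps)
  with e have f0: "f \<noteq> 0" by auto
  have deg: "degree f \<le> 6"
    unfolding f_def p_def r_def a_def b_def by (simp add: eval_nat_numeral)
  have sub: "T \<subseteq> {x. poly f x = 0}" using root by auto
  show fin: "finite T" using finite_subset[OF sub poly_roots_finite[OF f0]] .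
  have "card T \<le> card {x. poly f x = 0}" by (rule card_mono[OF poly_roots_finite[OF f0] sub])
  also have "\<dots> \<le> degree f" by (rule card_poly_roots_bound[OF f0])
  finally show "card T \<le> 6" using deg by simp
qed

lemma card_projective_norm_le:
  fixes \<sigma> \<tau> :: "'a :: field \<Rightarrow> 'a" and A \<alpha> :: "nat \<Rightarrow> 'a"
  assumes add: "\<And>x y. \<sigma> (x + y) = \<sigma> x + \<sigma> y" "\<And>x y. \<tau> (x + y) = \<tau> x + \<tau> y"
    and mult: "\<And>x y. \<sigma> (x * y) = \<sigma> x * \<sigma> y" "\<And>x y. \<tau> (x * y) = \<tau> x * \<tau> y"
    and one: "\<sigma> 1 = 1" "\<tau> 1 = 1"
    and A: "inj_on A {..<4}"
    and \<alpha>: "\<And>i. i < 4 \<Longrightarrow> \<alpha> i \<noteq> 0"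
    and Z: "\<And>z. z \<in> Z \<Longrightarrow> \<exists>c. c \<noteq> 0 \<and>
      (\<forall>i<4. (z + A i) * \<sigma> (z + A i) * \<tau> (z + A i) = \<alpha> i * c)"
  shows "card Z \<le> 6"
proof -
  define N where "N = (\<lambda>x. x * \<sigma> x * \<tau> x)"
  have N_mult: "N (x * y) = N x * N y" for x y by (simp add: N_def mult)
  have N_1: "N 1 = 1" by (simp add: N_def one)
  have N_0: "N x \<noteq> 0 \<longleftrightarrow> x \<noteq> 0" for x
    by (metis N_1 N_def N_mult mult_zero_left right_inverse zero_neq_one)
  have N_div: "N (x / y) = N x / N y" for x y
  proof (cases "y = 0")
    case True
    then show ?thesis using N_0[of 0] by simp
  next
    case False
    have "N (x / y) * N y = N x" using False by (simp flip: N_mult)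
    then show ?thesis using N_0[of y] False by (simp add: field_simps)
  qed
  have minus: "\<sigma> (x - y) = \<sigma> x - \<sigma> y" "\<tau> (x - y) = \<tau> x - \<tau> y" for x y
    using add[of "x - y" y] by simp_all
  (* Dividing by the equation for i = 0 and inverting z + A 0 turns the four equations into three
     without the unknown c; t is the unknown after an affine normalisation. *)
  define D where "D = (\<lambda>i. A i - A 0)"
  have D: "D 1 \<noteq> 0" "D 2 \<noteq> 0" "D 3 \<noteq> 0" "D 1 \<noteq> D 2" "D 1 \<noteq> D 3" "D 2 \<noteq> D 3"
    using inj_onD[OF A, of 1 0] inj_onD[OF A, of 2 0] inj_onD[OF A, of 3 0]
      inj_onD[OF A, of 1 2] inj_onD[OF A, of 1 3] inj_onD[OF A, of 2 3]
    by (auto simp: D_def)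
  \<comment> \<open>In terms of \<open>w = 1 / (z + A 0)\<close>, the norms of the
    \<open>w + 1 / D i\<close> are known. The affine map
    \<open>w \<mapsto> (w + 1 / D 1) / c\<close> sends the points \<open>- 1 / D 1\<close>,
    \<open>- 1 / D 2\<close>, \<open>- 1 / D 3\<close> to \<open>0\<close>, \<open>1\<close>,
    \<open>e\<close>.\<close>
  define c where "c = 1 / D 1 - 1 / D 2"
  define d where "d = 1 / D 1 - 1 / D 3"
  have c: "c \<noteq> 0" and d: "d \<noteq> 0" and cd: "c \<noteq> d"
    using D by (auto simp: c_def d_def)
  define e where "e = d / c"
  have e: "e \<noteq> 0" "e \<noteq> 1" using c d cd by (auto simp: e_def)
  have \<sigma>0: "\<sigma> x \<noteq> 0 \<and> \<tau> x \<noteq> 0" if "x \<noteq> 0" for x using N_0[of x] that by (auto simp: N_def)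
  have e': "\<sigma> e \<noteq> 0" "\<tau> e \<noteq> 0" "\<sigma> e \<noteq> 1" "\<tau> e \<noteq> 1"
    using \<sigma>0[OF e(1)] \<sigma>0[of "e - 1"] e(2) by (auto simp: minus one)
  define t where "t = (\<lambda>z. (1 / (z + A 0) + 1 / D 1) / c)"
  define \<mu> where "\<mu> = (\<lambda>i. \<alpha> i / (\<alpha> 0 * (N (D i) * N c)))"
  \<comment> \<open>The conjugates \<open>\<sigma> x\<close> and \<open>\<tau> x\<close> are
    replaced by independent unknowns \<open>y\<close> and \<open>z\<close>, which makes the
    conditions polynomial of bounded degree.\<close>
  define T where "T = {x. \<exists>y z. x * y * z = \<mu> 1 \<and> (x - 1) * (y - 1) * (z - 1) = \<mu> 2
                   \<and> (x - e) * (y - \<sigma> e) * (z - \<tau> e) = \<mu> 3}"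
  have \<mu>1: "\<mu> 1 \<noteq> 0" using \<alpha>[of 1] \<alpha>[of 0] D(1) c by (simp add: \<mu>_def N_0)
  have T: "finite T" "card T \<le> 6"
    unfolding T_def using card_three_cubics_le[OF e'(1,3,2,4) \<mu>1] by auto
  have nz: "z + A i \<noteq> 0" if z: "z \<in> Z" and i: "i < 4" for z i
  proof
    assume 0: "z + A i = 0"
    from Z[OF z] obtain g where "g \<noteq> 0" "N (z + A i) = \<alpha> i * g" using i by (auto simp: N_def)
    with 0 N_0[of 0] \<alpha>[OF i] show False by simp
  qed
  have "t ` Z \<subseteq> T"
  proof (rule image_subsetI)
    fix z assume z: "z \<in> Z"
    obtain g where g: "g \<noteq> 0" "\<And>i. i < 4 \<Longrightarrow> N (z + A i) = \<alpha> i * g"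
      using Z[OF z] by (auto simp: N_def)
    have z0: "z + A 0 \<noteq> 0" using nz[OF z] by simp
    have key: "N ((1 / (z + A 0) + 1 / D i) / c) = \<mu> i" if i: "i < 4" "D i \<noteq> 0" for i
    proof -
      have "(1 / (z + A 0) + 1 / D i) / c = (z + A i) / ((z + A 0) * (D i * c))"
        using z0 i c by (simp add: field_simps) (simp add: D_def algebra_simps)
      also have "N \<dots> = \<mu> i"
        using g \<alpha>[of 0] i by (simp add: N_div N_mult \<mu>_def)
      finally show ?thesis .
    qed
    have "t z - 1 = (1 / (z + A 0) + 1 / D 2) / c"
    proof -
      have "t z - 1 = t z - c / c" using c by simp
      also have "\<dots> = (1 / (z + A 0) + 1 / D 2) / c"
        unfolding t_def diff_divide_distrib[symmetric] by (simp add: c_def)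
      finally show ?thesis .
    qed
    moreover have "t z - e = (1 / (z + A 0) + 1 / D 3) / c"
      unfolding t_def e_def by (simp add: d_def flip: diff_divide_distrib)
    moreover have "t z = (1 / (z + A 0) + 1 / D 1) / c" by (simp add: t_def)
    ultimately have "N (t z) = \<mu> 1" "N (t z - 1) = \<mu> 2" "N (t z - e) = \<mu> 3"
      using key[of 1] key[of 2] key[of 3] D by auto
    then show "t z \<in> T"
      unfolding T_def N_def minus one by blast
  qed
  moreover have "inj_on t Z"
    using c by (auto intro!: inj_onI simp: t_def)
  ultimately show ?thesis
    using T card_inj_on_le[of t Z T] by simp
qed

subsection \<open>Finite fields inside an algebraic closure\<close>

text \<open>A linear factor that occurs twice in the factorization of \<open>f\<close> gives a
  common root of \<open>f\<close> and its derivative, so all factors are distinct.\<close>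

lemma card_roots_separable:
  fixes f :: "'a :: alg_closed_field poly"
  assumes f0: "f \<noteq> 0" and sep: "\<And>x. poly f x = 0 \<Longrightarrow> poly (pderiv f) x \<noteq> 0"
  shows "card {x. poly f x = 0} = degree f"
proof -
  obtain A where A: "size A = degree f" "f = smult (lead_coeff f) (\<Prod>x\<in>#A. [:- x, 1:])"
    using alg_closed_imp_factorization[OF f0] by blast
  have roots: "{x. poly f x = 0} = set_mset A"
    using f0 by (subst A(2)) (auto simp: poly_prod_mset)
  have "count A x \<le> 1" for x
  proof (rule ccontr)
    assume "\<not> count A x \<le> 1"
    then have "x \<in># A" "x \<in># A - {#x#}"
      by (auto simp flip: count_greater_zero_iff)
    then obtain B where "A = add_mset x (add_mset x B)"
      by (metis mset_add add_mset_remove_trivial)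
    then have "(\<Prod>x\<in>#A. [:- x, 1:]) = [:- x, 1:] * ([:- x, 1:] * (\<Prod>x\<in>#B. [:- x, 1:]))"
      by simp
    then obtain g where "f = [:- x, 1:] * ([:- x, 1:] * g)"
      using A(2) by (metis mult_smult_right)
    then have "poly f x = 0" "poly (pderiv f) x = 0"
      by (simp_all add: pderiv_mult del: mult_pCons_left mult_pCons_right)
    with sep show False by blast
  qed
  then have "count A x = (if x \<in># A then 1 else 0)" for x
    by (metis One_nat_def count_greater_zero_iff le_antisym less_eq_Suc_le not_in_iff)
  then have "A = mset_set (set_mset A)"
    by (intro multiset_eqI) (simp add: count_mset_set')
  then have "card (set_mset A) = size A"
    by (metis size_mset_set)
  with roots A(1) show ?thesis by simp
qed

text \<open>The fixed points are the roots of \<open>X ^ q - X\<close>, whose derivative is the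
  constant -1. They form the subfield with \<open>q\<close> elements.\<close>

lemma card_frobenius_fixed_points:
  assumes "prime CHAR('a :: alg_closed_field)" and n: "n > 0" and q: "q = CHAR('a) ^ n"
  shows "card {x :: 'a. x ^ q = x} = q"
proof -
  have q2: "q \<ge> 2"
    using prime_ge_2_nat[OF assms(1)] self_le_power[of "CHAR('a)" n] n unfolding q by linarith
  define f :: "'a poly" where "f = monom 1 q - monom 1 1"
  have deg: "degree f = q"
    unfolding f_def diff_conv_add_uminus using q2
    by (subst degree_add_eq_left) (auto simp: degree_monom_eq)
  have "of_nat q = (0 :: 'a)"
    using n by (simp add: q zero_power)
  then have "pderiv f = -1"
    by (simp add: f_def pderiv_diff pderiv_monom monom_0 flip: one_pCons)
  moreover have "f \<noteq> 0" using deg q2 by auto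
  ultimately show ?thesis
    using card_roots_separable[of f] deg by (simp add: f_def poly_monom)
qed

text \<open>Greedy choice: the combinations of \<open>d\<close> elements over the prime field number
  at most \<open>p ^ d\<close>, so a larger set \<open>F\<close> contains an element outside them.
  Integer coefficients modulo \<open>p\<close> stand in for a vector space structure.\<close>

lemma ex_independent_over_prime_field:
  fixes F :: "'a :: field set"
  assumes p: "prime p" "p = CHAR('a)" and F: "p ^ d \<le> card F"
  shows "\<exists>e. e ` {..<d} \<subseteq> F \<and>
    (\<forall>n :: nat \<Rightarrow> int. (\<Sum>i<d. of_int (n i) * e i) = 0 \<longrightarrow> (\<forall>i<d. int p dvd n i))"
  using F
proof (induction d)
  case 0
  then show ?case by auto
next
  case (Suc d)
  have p1: "p > 1" using prime_gt_1_nat[OF p(1)] .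
  then have pd: "p ^ d < p ^ Suc d" by simp
  with Suc.prems have "p ^ d \<le> card F" by linarith
  from Suc.IH[OF this] obtain e where e: "e ` {..<d} \<subseteq> F"
    and ind: "\<And>n :: nat \<Rightarrow> int. (\<Sum>i<d. of_int (n i) * e i) = 0 \<Longrightarrow> \<forall>i<d. int p dvd n i"
    by blast
  define g where "g = (\<lambda>n :: nat \<Rightarrow> nat. \<Sum>i<d. of_int (int (n i)) * e i)"
  define S where "S = g ` (PiE {..<d} (\<lambda>_. {..<p}))"
  have finS: "finite S" unfolding S_def by (intro finite_imageI finite_PiE) auto
  have "card S \<le> p ^ d"
    unfolding S_def by (rule order_trans[OF card_image_le]) (auto simp: finite_PiE card_PiE)
  also have "\<dots> < card F" using pd Suc.prems by linarith
  finally have "\<not> F \<subseteq> S" using card_mono[OF finS] by (meson linorder_not_less)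
  then obtain x where x: "x \<in> F" "x \<notin> S" by blast
  define e' where "e' = e(d := x)"
  have sum': "(\<Sum>i<Suc d. of_int (n i) * e' i) = (\<Sum>i<d. of_int (n i) * e i) + of_int (n d) * x"
    for n :: "nat \<Rightarrow> int"
    by (simp add: e'_def)
  have reduce: "(of_int (k mod int p) :: 'a) = of_int k" for k
    unfolding p(2) by (simp add: of_int_eq_iff_cong_CHAR cong_def)
  have "\<forall>i<Suc d. int p dvd n i" if 0: "(\<Sum>i<Suc d. of_int (n i) * e' i) = 0" for n :: "nat \<Rightarrow> int"
  proof -
    \<comment> \<open>Otherwise \<open>n d\<close> has an inverse \<open>u\<close> modulo
      \<open>p\<close>, and solving the relation for \<open>x\<close> makes it a combination of the
      earlier elements. Reducing the coefficients modulo \<open>p\<close> places \<open>x\<close> in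
      \<open>S\<close>.\<close>
    have dvd: "int p dvd n d"
    proof (rule ccontr)
      assume "\<not> int p dvd n d"
      then have "coprime (n d) (int p)"
        using p(1) by (metis coprime_commute prime_imp_coprime prime_nat_int_transfer)
      then obtain u where u: "[n d * u = 1] (mod int p)"
        using cong_solve_coprime_int by blast
      define w where "w = (\<lambda>i\<in>{..<d}. nat ((- u * n i) mod int p))"
      have u1: "of_int u * of_int (n d) = (1 :: 'a)"
        using u unfolding p(2) by (simp flip: of_int_eq_iff_cong_CHAR add: mult.commute)
      have "g w = (\<Sum>i<d. of_int (- u * n i) * e i)"
        unfolding g_def w_def using p1 by (intro sum.cong) (auto simp: reduce simp del: of_int_mult of_int_minus mult_minus_left)
      also have "\<dots> = - of_int u * (\<Sum>i<d. of_int (n i) * e i)"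
        by (simp add: sum_distrib_left mult.assoc sum_negf)
      also have "(\<Sum>i<d. of_int (n i) * e i) = - (of_int (n d) * x)"
        using 0 unfolding sum' by (simp add: eq_neg_iff_add_eq_0)
      also have "- of_int u * - (of_int (n d) * x) = x"
        using u1 by (simp flip: mult.assoc)
      finally have "g w = x" .
      moreover have "w \<in> PiE {..<d} (\<lambda>_. {..<p})"
        using p1 by (auto simp: w_def nat_less_iff)
      ultimately show False using x(2) by (auto simp: S_def)
    qed
    then have "of_int (n d) = (0 :: 'a)"
      using p(2) by (simp add: of_int_eq_0_iff_char_dvd)
    with 0 have "(\<Sum>i<d. of_int (n i) * e i) = 0" unfolding sum' by simp
    from ind[OF this] dvd show ?thesis by (auto simp: less_Suc_eq)
  qed
  moreover have "e' ` {..<Suc d} \<subseteq> F"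
    using e x(1) by (auto simp: e'_def less_Suc_eq)
  ultimately show ?case by blast
qed

text \<open>Two coefficients in \<open>{0..<p}\<close> that are congruent modulo \<open>p\<close>
  are equal, so independence makes the map injective on the box.\<close>

lemma ex_box_embedding:
  fixes F :: "'a :: field set"
  assumes p: "prime p" "p = CHAR('a)" and F: "p ^ d \<le> card F"
  shows "\<exists>e. e ` {..<d} \<subseteq> F \<and>
    (\<forall>a b. (\<forall>i<d. a i < p \<and> b i < p) \<and> (\<Sum>i<d. of_nat (a i) * e i) = (\<Sum>i<d. of_nat (b i) * e i)
       \<longrightarrow> (\<forall>i<d. a i = b i))"
proof -
  obtain e where e: "e ` {..<d} \<subseteq> F"
    and ind: "\<And>n :: nat \<Rightarrow> int. (\<Sum>i<d. of_int (n i) * e i) = 0 \<Longrightarrow> \<forall>i<d. int p dvd n i"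
    using ex_independent_over_prime_field[OF assms] by blast
  have "a i = b i"
    if lt: "\<forall>i<d. a i < p \<and> b i < p"
      and eq: "(\<Sum>i<d. of_nat (a i) * e i) = (\<Sum>i<d. of_nat (b i) * e i)" and i: "i < d" for a b i
  proof -
    have "(\<Sum>i<d. of_int (int (a i) - int (b i)) * e i) = 0"
      using eq by (simp add: left_diff_distrib sum_subtractf)
    from ind[OF this] i have "int p dvd int (a i) - int (b i)" by blast
    moreover have "\<bar>int (a i) - int (b i)\<bar> < int p" using lt i by auto
    ultimately show ?thesis using dvd_imp_le_int[of "int (a i) - int (b i)" "int p"] by linarith
  qed
  with e show ?thesis by blast
qed

subsection \<open>Common neighbours\<close>

definition dot :: "nat \<Rightarrow> (nat \<Rightarrow> nat) \<Rightarrow> (nat \<Rightarrow> nat) \<Rightarrow> nat" where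
  "dot d u v = (\<Sum>i<d. u i * v i)"

lemma dot_commute: "dot d u v = dot d v u"
  by (simp add: dot_def mult.commute)

text \<open>The alternating sum is the inner product of \<open>u - u'\<close> and
  \<open>v - v'\<close>, and the assumption says that these vectors are opposite.\<close>

lemma int_dot_parallelogram:
  assumes "\<And>i. i < d \<Longrightarrow> u i + v i = u' i + v' i"
  shows "int (dot d u v) + int (dot d u' v') - int (dot d u v') - int (dot d u' v)
    = - (\<Sum>i<d. (int (u i) - int (u' i))\<^sup>2)"
proof -
  have "int (dot d u v) + int (dot d u' v') - int (dot d u v') - int (dot d u' v)
    = (\<Sum>i<d. (int (u i) - int (u' i)) * (int (v i) - int (v' i)))"
    unfolding dot_def of_nat_sum by (simp add: algebra_simps sum.distrib sum_subtractf)
  also have "\<dots> = (\<Sum>i<d. - (int (u i) - int (u' i))\<^sup>2)"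
  proof (intro sum.cong refl)
    fix i assume "i \<in> {..<d}"
    with assms[of i] have "int (v i) - int (v' i) = - (int (u i) - int (u' i))"
      by force
    then show "(int (u i) - int (u' i)) * (int (v i) - int (v' i)) = - (int (u i) - int (u' i))\<^sup>2"
      by (simp only: power2_eq_square mult_minus_right)
  qed
  finally show ?thesis by (simp add: sum_negf)
qed

text \<open>The assumption \<open>freiman\<close> says that \<open>\<beta>\<close> is injective on
  sums of two box points. It lifts additive coincidences in the field to integer vectors, where a
  sum of squares vanishes only trivially.\<close>

locale norm_triple_system =
  fixes \<sigma> \<tau> :: "'a :: field \<Rightarrow> 'a" and \<beta> :: "(nat \<Rightarrow> nat) \<Rightarrow> 'a"
    and d :: nat and B :: "(nat \<Rightarrow> nat) set" and r :: nat
  assumes hom_add: "\<And>x y. \<sigma> (x + y) = \<sigma> x + \<sigma> y" "\<And>x y. \<tau> (x + y) = \<tau> x + \<tau> y"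
    and hom_mult: "\<And>x y. \<sigma> (x * y) = \<sigma> x * \<sigma> y" "\<And>x y. \<tau> (x * y) = \<tau> x * \<tau> y"
    and hom_one: "\<sigma> 1 = 1" "\<tau> 1 = 1"
    and B_extensional: "B \<subseteq> extensional {..<d}"
    and freiman: "\<And>u v u' v'. \<lbrakk>u \<in> B; v \<in> B; u' \<in> B; v' \<in> B; \<beta> u + \<beta> v = \<beta> u' + \<beta> v'\<rbrakk>
        \<Longrightarrow> \<forall>i<d. u i + v i = u' i + v' i"
begin

definition N :: "'a \<Rightarrow> 'a" where "N x = x * \<sigma> x * \<tau> x"

definition triple :: "(nat \<Rightarrow> nat) \<times> 'a \<Rightarrow> (nat \<Rightarrow> nat) \<times> 'a \<Rightarrow> (nat \<Rightarrow> nat) \<times> 'a \<Rightarrow> bool" where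
  "triple P Q R \<longleftrightarrow>
     N (\<beta> (fst P) + \<beta> (fst Q) + \<beta> (fst R)) = snd P * snd Q * snd R \<and>
     dot d (fst P) (fst Q) + dot d (fst P) (fst R) + dot d (fst Q) (fst R) = r"

lemma triple_swap:
  assumes "triple P Q R"
  shows "triple Q P R" "triple P R Q"
  using assms by (auto simp: triple_def dot_commute ac_simps)

lemma beta_inj:
  assumes "u \<in> B" "v \<in> B" "\<beta> u = \<beta> v"
  shows "u = v"
proof -
  have "\<forall>i<d. u i + u i = v i + v i" using assms by (intro freiman) auto
  then have "u i = v i" if "i < d" for i using that by (metis add_self_div_2)
  moreover have "u \<in> extensional {..<d}" "v \<in> extensional {..<d}" using assms B_extensional by auto
  ultimately show ?thesis by (intro extensionalityI[of u "{..<d}"]) auto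
qed

text \<open>The norm equation can be solved for \<open>snd P\<close>. Thus distinct vertices that
  share a neighbouring pair have distinct box points.\<close>

lemma triple_unique:
  assumes "triple P Q R" "triple P' Q R" "fst P = fst P'" "snd Q \<noteq> 0" "snd R \<noteq> 0"
  shows "P = P'"
  using assms by (auto simp: triple_def prod_eq_iff)

text \<open>Summing the condition on \<open>dot\<close> over the square \<open>P\<close>, \<open>P'\<close>, \<open>Q\<close>, \<open>Q'\<close> with alternating
  signs leaves minus the squared length of \<open>fst P - fst P'\<close>.\<close>

lemma no_parallelogram:
  assumes "triple P Q R" "triple P' Q R" "triple P Q' R" "triple P' Q' R"
    and B: "fst P \<in> B" "fst P' \<in> B" "fst Q \<in> B" "fst Q' \<in> B"
    and eq: "\<beta> (fst P) + \<beta> (fst Q) = \<beta> (fst P') + \<beta> (fst Q')"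
  shows "fst P = fst P'"
proof -
  have "\<forall>i<d. fst P i + fst Q i = fst P' i + fst Q' i" using B eq by (intro freiman)
  then have "- (\<Sum>i<d. (int (fst P i) - int (fst P' i))\<^sup>2) =
      int (dot d (fst P) (fst Q)) + int (dot d (fst P') (fst Q'))
      - int (dot d (fst P) (fst Q')) - int (dot d (fst P') (fst Q))"
    by (intro int_dot_parallelogram[symmetric]) auto
  also have "\<dots> = 0" using assms(1-4) by (simp add: triple_def)
  finally have "\<forall>i<d. int (fst P i) - int (fst P' i) = 0"
    by (simp add: sum_nonneg_eq_0_iff)
  moreover have "fst P \<in> extensional {..<d}" "fst P' \<in> extensional {..<d}"
    using B B_extensional by auto
  ultimately show ?thesis by (intro extensionalityI[of "fst P" "{..<d}"]) auto
qed

lemma card_common_neighbours_le: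
  assumes W: "P \<in> W" "P' \<in> W" "Q \<in> W" "Q' \<in> W" "W \<subseteq> B \<times> (- {0})"
    and neq: "P \<noteq> P'" "Q \<noteq> Q'"
  shows "card {R \<in> W. triple P Q R \<and> triple P' Q R \<and> triple P Q' R \<and> triple P' Q' R} \<le> 6"
    (is "card ?S \<le> 6")
proof (cases "?S = {}")
  case False
  \<comment> \<open>A single common neighbour suffices to show that the box points and the four sums
    are distinct.\<close>
  then obtain R0 where R0: "R0 \<in> W" "triple P Q R0" "triple P' Q R0" "triple P Q' R0" "triple P' Q' R0"
    by blast
  have WB: "fst V \<in> B" and W0: "snd V \<noteq> 0" if "V \<in> W" for V using that W(5) by auto
  have PP: "fst P \<noteq> fst P'"
    using triple_unique[OF R0(2,3)] neq(1) W0 W R0(1) by blast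
  have QQ: "fst Q \<noteq> fst Q'"
    using triple_unique[OF triple_swap(1)[OF R0(2)] triple_swap(1)[OF R0(4)]] neq(2) W0 W R0(1) by blast
  define A where "A = (\<lambda>i. [\<beta> (fst P) + \<beta> (fst Q), \<beta> (fst P') + \<beta> (fst Q),
      \<beta> (fst P) + \<beta> (fst Q'), \<beta> (fst P') + \<beta> (fst Q')] ! i)"
  define \<alpha> where "\<alpha> = (\<lambda>i. [snd P * snd Q, snd P' * snd Q, snd P * snd Q', snd P' * snd Q'] ! i)"
  have bP: "\<beta> (fst P) \<noteq> \<beta> (fst P')" and bQ: "\<beta> (fst Q) \<noteq> \<beta> (fst Q')"
    using beta_inj PP QQ WB W by blast+
  have d1: "\<beta> (fst P) + \<beta> (fst Q) \<noteq> \<beta> (fst P') + \<beta> (fst Q')"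
    using no_parallelogram[OF R0(2,3,4,5)] PP WB W by blast
  have d2: "\<beta> (fst P) + \<beta> (fst Q') \<noteq> \<beta> (fst P') + \<beta> (fst Q)"
    using no_parallelogram[OF R0(4,5,2,3)] PP WB W by blast
  have less4: "i < 4 \<longleftrightarrow> i = 0 \<or> i = 1 \<or> i = 2 \<or> i = 3" for i :: nat by auto
  \<comment> \<open>Sums that share a summand are separated by \<open>bP\<close> and
    \<open>bQ\<close>, the two diagonal pairs by \<open>d1\<close> and \<open>d2\<close>.\<close>
  have "inj_on A {..<4}"
    using bP bQ d1 d2 by (auto simp: inj_on_def A_def less4)
  moreover have "\<alpha> i \<noteq> 0" if "i < 4" for i
    using that W0[OF W(1)] W0[OF W(2)] W0[OF W(3)] W0[OF W(4)] by (auto simp: \<alpha>_def less4)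
  moreover have "\<exists>c. c \<noteq> 0 \<and> (\<forall>i<4. (z + A i) * \<sigma> (z + A i) * \<tau> (z + A i) = \<alpha> i * c)"
    if "z \<in> (\<lambda>R. \<beta> (fst R)) ` ?S" for z
  proof -
    from that obtain R where R: "R \<in> ?S" "z = \<beta> (fst R)" by blast
    then have "\<forall>i<4. N (z + A i) = \<alpha> i * snd R"
      by (auto simp: triple_def A_def \<alpha>_def less4 ac_simps)
    moreover have "snd R \<noteq> 0" using R W0 by blast
    ultimately show ?thesis unfolding N_def by blast
  qed
  ultimately have "card ((\<lambda>R. \<beta> (fst R)) ` ?S) \<le> 6"
    using card_projective_norm_le[OF hom_add hom_mult hom_one, of A \<alpha>] by blast
  moreover have "inj_on (\<lambda>R. \<beta> (fst R)) ?S"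
  proof (rule inj_onI)
    fix R R' assume R: "R \<in> ?S" "R' \<in> ?S" "\<beta> (fst R) = \<beta> (fst R')"
    then have "fst R = fst R'" using beta_inj WB by blast
    moreover have "triple R P Q" "triple R' P Q" using R triple_swap by blast+
    ultimately show "R = R'" using triple_unique W0 W by blast
  qed
  ultimately show ?thesis by (simp add: card_image)
qed (metis card.empty zero_le)

end

subsection \<open>Tripartite 3-graphs\<close>

lemma insert3_eq_cases:
  assumes "{a, b, c} = {u, v, w}" "u \<noteq> v" "u \<noteq> w" "v \<noteq> w"
  shows "a = u \<and> b = v \<and> c = w \<or> a = u \<and> b = w \<and> c = v \<or> a = v \<and> b = u \<and> c = w \<or>
    a = v \<and> b = w \<and> c = u \<or> a = w \<and> b = u \<and> c = v \<or> a = w \<and> b = v \<and> c = u"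
proof -
  have "a = u \<or> a = v \<or> a = w" "b = u \<or> b = v \<or> b = w" "c = u \<or> c = v \<or> c = w"
    "u = a \<or> u = b \<or> u = c" "v = a \<or> v = b \<or> v = c" "w = a \<or> w = b \<or> w = c"
    using assms(1) by blast+
  with assms(2-4) show ?thesis by metis
qed

text \<open>The graph is relabelled into \<open>{..<n}\<close> and the remaining vertices are
  isolated. Since every vertex of \<open>H\<close> lies in an edge, a copy of \<open>H\<close>
  avoids the isolated vertices and can be pulled back.\<close>

lemma ex3_ge:
  fixes G :: "'a hypergraph" and H :: "'b hypergraph"
  assumes G: "three_graph G" "\<not> contains_copy G H" "card (verts G) \<le> n"
    and H: "verts H \<subseteq> \<Union> (edges H)"
  shows "card (edges G) \<le> ex3 n H"
proof -
  have fin: "finite (verts G)" and sub: "\<And>e. e \<in> edges G \<Longrightarrow> e \<subseteq> verts G"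
    and card3: "\<And>e. e \<in> edges G \<Longrightarrow> card e = 3"
    using G(1) by (auto simp: three_graph_def)
  obtain h where h: "inj_on h (verts G)" "h ` verts G \<subseteq> {..<n}"
    using card_le_inj[OF fin, of "{..<n}"] G(3) by auto
  define G' where "G' = ({..<n}, (`) h ` edges G)"
  have V: "verts G' = {..<n}" and E: "edges G' = (`) h ` edges G"
    by (simp_all add: G'_def verts_def edges_def)
  have "inj_on ((`) h) (edges G)"
    by (rule inj_on_subset[OF inj_on_image_Pow[OF h(1)]]) (use sub in auto)
  then have card: "card (edges G') = card (edges G)"
    unfolding E by (rule card_image)
  have "three_graph G'"
    unfolding three_graph_def V E
    using h sub card3 by (auto simp: card_image[OF inj_on_subset[OF h(1)]])
  moreover have "\<not> contains_copy G' H"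
  proof
    assume "contains_copy G' H"
    then obtain f where f: "inj_on f (verts H)" "\<And>e. e \<in> edges H \<Longrightarrow> f ` e \<in> edges G'"
      by (auto simp: contains_copy_def)
    define g where "g = inv_into (verts G) h"
    have edge: "(g \<circ> f) ` e \<in> edges G \<and> f ` e \<subseteq> h ` verts G" if e: "e \<in> edges H" for e
    proof -
      obtain e' where e': "e' \<in> edges G" "f ` e = h ` e'" using f(2)[OF e] by (auto simp: E)
      have "(g \<circ> f) ` e = g ` h ` e'" using e'(2) by (metis image_comp)
      also have "\<dots> = e'" unfolding g_def by (rule inv_into_image_cancel[OF h(1) sub[OF e'(1)]])
      finally show ?thesis using e' sub[OF e'(1)] by auto
    qed
    have im: "f ` verts H \<subseteq> h ` verts G" using H edge by blast
    have "inj_on (g \<circ> f) (verts H)"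
      unfolding g_def by (intro comp_inj_on f(1) inj_on_subset[OF inj_on_inv_into im]) simp
    moreover have "(g \<circ> f) ` verts H \<subseteq> verts G"
      unfolding g_def using im inv_into_into[of _ h "verts G"] by fastforce
    ultimately have "contains_copy G H" unfolding contains_copy_def using edge by blast
    with G(2) show False ..
  qed
  moreover have "finite {card (edges G) | G :: nat hypergraph.
     three_graph G \<and> verts G = {..<n} \<and> \<not> contains_copy G H}"
    by (rule finite_subset[of _ "card ` Pow (Pow {..<n})"]) (auto simp: three_graph_def)
  ultimately show ?thesis
    unfolding ex3_def card[symmetric] using V by - (rule Max_ge, assumption, rule CollectI, rule exI[of _ G'], simp)
qed

text \<open>Each colour class is its own copy of \<open>W\<close>, so triples with repeated entries
  still give edges of size 3, and edges correspond to ordered triples.\<close>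

definition tripartite_of :: "'a set \<Rightarrow> ('a \<Rightarrow> 'a \<Rightarrow> 'a \<Rightarrow> bool) \<Rightarrow> (nat \<times> 'a) hypergraph" where
  "tripartite_of W T = ({..<3} \<times> W,
     {{(0, P), (1, Q), (2, R)} | P Q R. P \<in> W \<and> Q \<in> W \<and> R \<in> W \<and> T P Q R})"

lemma verts_tripartite_of: "verts (tripartite_of W T) = {..<3} \<times> W"
  by (simp add: tripartite_of_def verts_def)

lemma edges_tripartite_of:
  "edges (tripartite_of W T) =
     (\<lambda>(P, Q, R). {(0, P), (1, Q), (2, R)}) ` {(P, Q, R) \<in> W \<times> W \<times> W. T P Q R}"
  by (auto simp: tripartite_of_def edges_def)

lemma card_edges_tripartite_of:
  "card (edges (tripartite_of W T)) = card {(P, Q, R) \<in> W \<times> W \<times> W. T P Q R}"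
  unfolding edges_tripartite_of
proof (rule card_image, rule inj_onI)
  fix x y :: "'a \<times> 'a \<times> 'a"
  obtain P Q R P' Q' R' where xy: "x = (P, Q, R)" "y = (P', Q', R')"
    by (metis prod_cases3)
  assume "(case x of (P, Q, R) \<Rightarrow> {(0 :: nat, P), (1, Q), (2, R)}) =
    (case y of (P, Q, R) \<Rightarrow> {(0, P), (1, Q), (2, R)})"
  then have "{(0 :: nat, P), (1, Q), (2, R)} = {(0, P'), (1, Q'), (2, R')}" by (simp add: xy)
  from insert3_eq_cases[OF this] show "x = y" by (simp add: xy)
qed

lemma three_graph_tripartite_of:
  assumes "finite W"
  shows "three_graph (tripartite_of W T)"
  using assms by (auto simp: three_graph_def verts_tripartite_of edges_tripartite_of)

lemma complete_tripartite_edge_iff: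
  "e \<in> edges (complete_tripartite r s t) \<longleftrightarrow>
     (\<exists>i j k. i < r \<and> j < s \<and> k < t \<and> e = {(1, i), (2, j), (3, k)})"
proof
  assume "e \<in> edges (complete_tripartite r s t)"
  then obtain x y z where e: "e = {x, y, z}"
    and xyz: "x \<in> {1} \<times> {..<r}" "y \<in> {2} \<times> {..<s}" "z \<in> {3} \<times> {..<t}"
    unfolding complete_tripartite_def edges_def Let_def snd_conv mem_Collect_eq by (elim exE conjE) (rule that)
  from xyz have "snd x < r \<and> snd y < s \<and> snd z < t \<and> e = {(1, snd x), (2, snd y), (3, snd z)}"
    unfolding e by auto
  then show "\<exists>i j k. i < r \<and> j < s \<and> k < t \<and> e = {(1, i), (2, j), (3, k)}" by (intro exI)
next
  assume "\<exists>i j k. i < r \<and> j < s \<and> k < t \<and> e = {(1, i), (2, j), (3, k)}"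
  then obtain i j k where "i < r" "j < s" "k < t" "e = {(1, i), (2, j), (3, k)}" by blast
  then show "e \<in> edges (complete_tripartite r s t)"
    unfolding complete_tripartite_def edges_def Let_def snd_conv mem_Collect_eq
    by (intro exI[of _ "(1, i)"] exI[of _ "(2, j)"] exI[of _ "(3, k)"]) simp
qed

lemma verts_complete_tripartite:
  "verts (complete_tripartite r s t) = {1} \<times> {..<r} \<union> {2} \<times> {..<s} \<union> {3} \<times> {..<t}"
  by (simp add: complete_tripartite_def verts_def Let_def)

lemma verts_complete_tripartite_covered:
  assumes "r > 0" "s > 0" "t > 0"
  shows "verts (complete_tripartite r s t) \<subseteq> \<Union> (edges (complete_tripartite r s t))"
proof
  fix x assume "x \<in> verts (complete_tripartite r s t)"
  then consider i where "x = (1, i)" "i < r" | i where "x = (2, i)" "i < s" | i where "x = (3, i)" "i < t"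
    unfolding verts_complete_tripartite by auto
  then obtain i j k where ijk: "i < r" "j < s" "k < t" and x: "x \<in> {(1, i), (2, j), (3, k)}"
  proof cases
    case (1 i)
    then show ?thesis using that[of i 0 0] assms by simp
  next
    case (2 i)
    then show ?thesis using that[of 0 i 0] assms by simp
  next
    case (3 i)
    then show ?thesis using that[of 0 0 i] assms by simp
  qed
  have "{(1, i), (2, j), (3, k)} \<in> edges (complete_tripartite r s t)"
    unfolding complete_tripartite_edge_iff using ijk by (intro exI[of _ i] exI[of _ j] exI[of _ k]) simp
  with x show "x \<in> \<Union> (edges (complete_tripartite r s t))" by (rule UnionI[rotated])
qed

text \<open>The two assumed transpositions generate all permutations of three arguments, so it does
  not matter which vertex of the edge carries which colour.\<close>

lemma tripartite_of_edgeD: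
  assumes sym: "\<And>P Q R. T P Q R \<Longrightarrow> T Q P R" "\<And>P Q R. T P Q R \<Longrightarrow> T P R Q"
    and e: "{x, y, z} \<in> edges (tripartite_of W T)"
  shows "T (snd x) (snd y) (snd z)" and "snd x \<in> W" "snd y \<in> W" "snd z \<in> W"
    and "{fst x, fst y, fst z} = {0, 1, 2}"
proof -
  obtain P Q R where PQR: "P \<in> W" "Q \<in> W" "R \<in> W" "T P Q R" "{x, y, z} = {(0, P), (1, Q), (2, R)}"
    using e by (auto simp: edges_tripartite_of)
  have T: "T P R Q" "T Q P R" "T Q R P" "T R P Q" "T R Q P"
    by (rule sym(2)[OF PQR(4)], rule sym(1)[OF PQR(4)], rule sym(2)[OF sym(1)[OF PQR(4)]],
      rule sym(1)[OF sym(2)[OF PQR(4)]], rule sym(1)[OF sym(2)[OF sym(1)[OF PQR(4)]]])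
  have "x = (0, P) \<and> y = (1, Q) \<and> z = (2, R) \<or> x = (0, P) \<and> y = (2, R) \<and> z = (1, Q) \<or>
      x = (1, Q) \<and> y = (0, P) \<and> z = (2, R) \<or> x = (1, Q) \<and> y = (2, R) \<and> z = (0, P) \<or>
      x = (2, R) \<and> y = (0, P) \<and> z = (1, Q) \<or> x = (2, R) \<and> y = (1, Q) \<and> z = (0, P)"
    by (rule insert3_eq_cases[OF PQR(5)]) simp_all
  then have "T (snd x) (snd y) (snd z) \<and> snd x \<in> W \<and> snd y \<in> W \<and> snd z \<in> W \<and>
      {fst x, fst y, fst z} = {0, 1, 2}"
    by (elim disjE) (simp_all add: T PQR(1-4) insert_commute)
  then show "T (snd x) (snd y) (snd z)" "snd x \<in> W" "snd y \<in> W" "snd z \<in> W"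
    "{fst x, fst y, fst z} = {0, 1, 2}" by simp_all
qed

text \<open>Vertices completing the same pair to an edge have the same colour, so each part of a
  copy is monochromatic and its vertices differ in their second components. The third part then
  injects into a common neighbourhood.\<close>

lemma tripartite_of_no_copy:
  assumes sym: "\<And>P Q R. T P Q R \<Longrightarrow> T Q P R" "\<And>P Q R. T P Q R \<Longrightarrow> T P R Q"
    and fin: "finite W" and t: "t > 0"
    and le: "\<And>P P' Q Q'. \<lbrakk>P \<in> W; P' \<in> W; Q \<in> W; Q' \<in> W; P \<noteq> P'; Q \<noteq> Q'\<rbrakk> \<Longrightarrow>
      card {R \<in> W. T P Q R \<and> T P' Q R \<and> T P Q' R \<and> T P' Q' R} < t"
  shows "\<not> contains_copy (tripartite_of W T) (complete_tripartite 2 2 t)"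
proof
  assume "contains_copy (tripartite_of W T) (complete_tripartite 2 2 t)"
  then obtain f where inj: "inj_on f (verts (complete_tripartite 2 2 t))"
    and f: "\<And>e. e \<in> edges (complete_tripartite 2 2 t) \<Longrightarrow> f ` e \<in> edges (tripartite_of W T)"
    by (auto simp: contains_copy_def)
  define x where "x = (\<lambda>i. f (1, i))"
  define y where "y = (\<lambda>i. f (2, i))"
  define z where "z = (\<lambda>i. f (3, i))"
  have E: "{x i, y j, z k} \<in> edges (tripartite_of W T)" if "i < 2" "j < 2" "k < t" for i j k
    using f[of "{(1, i), (2, j), (3, k)}"] that
    by (auto simp: complete_tripartite_edge_iff x_def y_def z_def)
  have D: "T (snd (x i)) (snd (y j)) (snd (z k))" "snd (x i) \<in> W" "snd (y j) \<in> W" "snd (z k) \<in> W"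
    "{fst (x i), fst (y j), fst (z k)} = {0, 1, 2}" if "i < 2" "j < 2" "k < t" for i j k
    by (rule tripartite_of_edgeD[where T = T, OF sym E[OF that]], assumption, assumption)+
  have inj': "inj_on x {..<2}" "inj_on y {..<2}" "inj_on z {..<t}"
    using inj by (auto simp: inj_on_def verts_complete_tripartite x_def y_def z_def)
  have F: "fst (x i) = 0 \<and> fst (y j) = 1 \<and> fst (z k) = 2 \<or> fst (x i) = 0 \<and> fst (y j) = 2 \<and> fst (z k) = 1 \<or>
      fst (x i) = 1 \<and> fst (y j) = 0 \<and> fst (z k) = 2 \<or> fst (x i) = 1 \<and> fst (y j) = 2 \<and> fst (z k) = 0 \<or>
      fst (x i) = 2 \<and> fst (y j) = 0 \<and> fst (z k) = 1 \<or> fst (x i) = 2 \<and> fst (y j) = 1 \<and> fst (z k) = 0"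
    if "i < 2" "j < 2" "k < t" for i j k
    using insert3_eq_cases[OF D(5)[OF that]] by simp
  have fst_x: "fst (x 0) = fst (x 1)"
    using F[of 0 0 0] F[of 1 0 0] t by auto
  have fst_y: "fst (y 0) = fst (y 1)"
    using F[of 0 0 0] F[of 0 1 0] t by auto
  have fst_z: "fst (z k) = fst (z l)" if "k < t" "l < t" for k l
    using F[of 0 0 k] F[of 0 0 l] that by auto
  have "snd (x 0) \<noteq> snd (x 1)" "snd (y 0) \<noteq> snd (y 1)"
    using fst_x fst_y inj_onD[OF inj'(1), of 0 1] inj_onD[OF inj'(2), of 0 1]
    by (auto simp: prod_eq_iff)
  then have "card {R \<in> W. T (snd (x 0)) (snd (y 0)) R \<and> T (snd (x 1)) (snd (y 0)) R \<and>
      T (snd (x 0)) (snd (y 1)) R \<and> T (snd (x 1)) (snd (y 1)) R} < t" (is "card ?S < t")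
    using D(2,3)[of 0 0 0] D(2,3)[of 1 1 0] t by (intro le) auto
  moreover have "card {..<t} \<le> card ?S"
  proof (rule card_inj_on_le)
    show "inj_on (\<lambda>k. snd (z k)) {..<t}"
    proof (rule inj_onI)
      fix k l assume kl: "k \<in> {..<t}" "l \<in> {..<t}" "snd (z k) = snd (z l)"
      then have "z k = z l" using fst_z[of k l] by (simp add: prod_eq_iff)
      from inj_onD[OF inj'(3) this kl(1,2)] show "k = l" .
    qed
    show "(\<lambda>k. snd (z k)) ` {..<t} \<subseteq> ?S"
      using D(1) D(4)[of 0 0] by auto
  qed (use fin in simp)
  ultimately show False by simp
qed

subsection \<open>Counting edges\<close>

lemma ex_large_fibre:
  assumes "finite A" "finite C" "C \<noteq> {}" "f ` A \<subseteq> C"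
  shows "\<exists>c\<in>C. card A \<le> card {a \<in> A. f a = c} * card C"
proof (rule ccontr)
  assume "\<not> ?thesis"
  then have "\<And>c. c \<in> C \<Longrightarrow> card {a \<in> A. f a = c} * card C < card A" by force
  then have "(\<Sum>c\<in>C. card {a \<in> A. f a = c} * card C) < (\<Sum>c\<in>C. card A)"
    using assms by (intro sum_strict_mono) auto
  moreover have "(\<Sum>c\<in>C. card {a \<in> A. f a = c}) = card A"
    using sum.group[OF assms(1,2,4), of "\<lambda>_. 1 :: nat"] by simp
  ultimately show False by (simp flip: sum_distrib_right)
qed

text \<open>The Frobenius map fixes the prime field.\<close>

lemma of_nat_power_CHAR_power:
  assumes "prime CHAR('a :: comm_semiring_1)"
  shows "(of_nat k :: 'a) ^ (CHAR('a) ^ n) = of_nat k"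
proof (induction k)
  case 0
  then show ?case using assms prime_gt_0_nat by (simp add: zero_power)
next
  case (Suc k)
  then show ?case by (simp add: freshmans_dream'[OF assms refl])
qed

text \<open>Three box points and two of the field elements are free, which gives the left-hand side;
  the norm equation forces the third element. The factor \<open>9 * m * M\<^sup>2 + 1\<close> counts
  the candidates for \<open>r\<close>. The condition \<open>3 * M < p\<close> keeps sums of three
  box coordinates below \<open>p\<close>.\<close>

lemma ex3_K227_ge:
  assumes p: "prime p" "p = CHAR('a :: alg_closed_field)" and M: "3 * M < p" and m: "m > 0"
    and n: "3 * (M ^ (3 * m) * (p ^ m - 1)) \<le> n"
  shows "M ^ (9 * m) * (p ^ m - 1)\<^sup>2 \<le> ex3 n (complete_tripartite 2 2 7) * (9 * m * M\<^sup>2 + 1)"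
proof -
  note prime = p(1)[unfolded p(2)]
  define q where "q = p ^ m"
  define d where "d = 3 * m"
  have qd: "q ^ 3 = p ^ d" by (simp add: q_def d_def flip: power_mult) (simp add: mult.commute)
  define F where "F = {x :: 'a. x ^ (p ^ d) = x}"
  have "card F = p ^ d"
    unfolding F_def using card_frobenius_fixed_points[OF prime _ refl, of d] m p(2) by (simp add: d_def)
  then obtain e where e: "e ` {..<d} \<subseteq> F"
    and ind: "\<And>a b. \<lbrakk>\<And>i. i < d \<Longrightarrow> a i < p \<and> b i < p; (\<Sum>i<d. of_nat (a i) * e i) = (\<Sum>i<d. of_nat (b i) * e i)\<rbrakk>
       \<Longrightarrow> \<forall>i<d. a i = b i"
    using ex_box_embedding[OF p, of d F] by auto
  define G where "G = {x :: 'a. x ^ q = x} - {0}"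
  have card_q: "card {x :: 'a. x ^ q = x} = q"
    using card_frobenius_fixed_points[OF prime m refl] by (simp add: q_def p(2))
  have q0: "q > 0" using prime_gt_0_nat[OF p(1)] by (simp add: q_def)
  have cardG: "card G = q - 1"
    unfolding G_def using card_q q0 by (subst card_Diff_singleton) (auto simp: zero_power)
  have finG: "finite G"
    unfolding G_def using card_q q0 by (simp add: card_ge_0_finite)
  \<comment> \<open>Coordinates start at 1, so that no sum of three box points is mapped to 0 and
    all norms that occur are nonzero.\<close>
  define B where "B = PiE {..<d} (\<lambda>_. {1..M})"
  have finB: "finite B" and cardB: "card B = M ^ d"
    by (simp_all add: B_def finite_PiE card_PiE)
  have B_le: "1 \<le> u i \<and> u i \<le> M" if "u \<in> B" "i < d" for u i
    using that by (auto simp: B_def PiE_iff)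
  define \<beta> where "\<beta> = (\<lambda>u :: nat \<Rightarrow> nat. \<Sum>i<d. of_nat (u i) * e i)"
  have \<beta>_add: "\<beta> u + \<beta> v = (\<Sum>i<d. of_nat (u i + v i) * e i)" for u v
    by (simp add: \<beta>_def sum.distrib algebra_simps)
  have frob: "(x + y) ^ (p ^ k) = x ^ (p ^ k) + y ^ (p ^ k)" for x y :: 'a and k
    using freshmans_dream'[OF prime refl] by (simp add: p(2))
  have \<beta>_F: "\<beta> u ^ (p ^ d) = \<beta> u" for u
  proof -
    have "\<beta> u ^ (p ^ d) = (\<Sum>i<d. (of_nat (u i) * e i) ^ (p ^ d))"
      unfolding \<beta>_def p(2) by (rule freshmans_dream_sum'[OF prime refl])
    also have "\<dots> = \<beta> u"
      unfolding \<beta>_def using e of_nat_power_CHAR_power[OF prime]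
      by (intro sum.cong) (auto simp: power_mult_distrib p(2) F_def)
    finally show ?thesis .
  qed
  have ns: "norm_triple_system (\<lambda>x. x ^ q) (\<lambda>x. x ^ (q ^ 2)) \<beta> d B"
  proof
    show "(x + y) ^ q = x ^ q + y ^ q" "(x + y) ^ q\<^sup>2 = x ^ q\<^sup>2 + y ^ q\<^sup>2" for x y :: 'a
      unfolding q_def power_mult[symmetric] by (rule frob)+
    show "B \<subseteq> extensional {..<d}" by (auto simp: B_def PiE_def)
    fix u v u' v' assume uv: "u \<in> B" "v \<in> B" "u' \<in> B" "v' \<in> B" and eq: "\<beta> u + \<beta> v = \<beta> u' + \<beta> v'"
    show "\<forall>i<d. u i + v i = u' i + v' i"
    proof (rule ind)
      fix i assume "i < d"
      then show "u i + v i < p \<and> u' i + v' i < p"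
        using M B_le[OF uv(1)] B_le[OF uv(2)] B_le[OF uv(3)] B_le[OF uv(4)] by fastforce
    qed (use eq in \<open>simp add: \<beta>_add\<close>)
  qed (simp_all add: power_mult_distrib)
  define N where "N = (\<lambda>x :: 'a. x * x ^ q * x ^ (q ^ 2))"
  have N_G: "N (\<beta> u + \<beta> v + \<beta> w) \<in> G" if "u \<in> B" "v \<in> B" "w \<in> B" for u v w
  proof -
    define s where "s = \<beta> u + \<beta> v + \<beta> w"
    have "s \<noteq> 0"
    proof
      assume "s = 0"
      then have "(\<Sum>i<d. of_nat (u i + v i + w i) * e i) = (\<Sum>i<d. of_nat 0 * e i)"
        by (simp add: s_def \<beta>_def sum.distrib algebra_simps)
      then have "\<forall>i<d. u i + v i + w i = 0"
      proof (rule ind[rotated])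
        fix i assume "i < d"
        then show "u i + v i + w i < p \<and> 0 < p"
          using M B_le[OF that(1)] B_le[OF that(2)] B_le[OF that(3)] by fastforce
      qed
      then show False using B_le[OF that(1), of 0] m by (simp add: d_def)
    qed
    \<comment> \<open>Hence the \<open>q\<close>-th power permutes \<open>s\<close>,
      \<open>s ^ q\<close>, \<open>s ^ (q ^ 2)\<close> cyclically and fixes their product
      \<open>N s\<close>.\<close>
    moreover have "s ^ (q ^ 3) = s"
      unfolding s_def qd by (simp add: frob \<beta>_F)
    then have "N s ^ q = N s"
      by (simp add: N_def power_mult_distrib flip: power_mult)
         (simp add: power2_eq_square power3_eq_cube mult_ac)
    ultimately show ?thesis unfolding s_def[symmetric] by (simp add: G_def N_def)
  qed
  define W where "W = B \<times> G"
  have finW: "finite W" and cardW: "card W = M ^ d * (q - 1)"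
    using finB finG by (simp_all add: W_def cardB cardG card_cartesian_product)
  define S where "S = {(P, Q, R) \<in> W \<times> W \<times> W.
    N (\<beta> (fst P) + \<beta> (fst Q) + \<beta> (fst R)) = snd P * snd Q * snd R}"
  have finS: "finite S"
    by (rule finite_subset[of _ "W \<times> W \<times> W"]) (use finW in \<open>auto simp: S_def\<close>)
  define \<phi> where "\<phi> = (\<lambda>(u, v, w, a, b). ((u, a), (v, b), (w, N (\<beta> u + \<beta> v + \<beta> w) / (a * b))))"
  have "M ^ (9 * m) * (q - 1)\<^sup>2 = card (B \<times> B \<times> B \<times> G \<times> G)"
    by (simp add: card_cartesian_product cardB cardG power2_eq_square d_def flip: power_add)
  also have "\<dots> \<le> card S"
  proof (rule card_inj_on_le[OF _ _ finS])
    show "inj_on \<phi> (B \<times> B \<times> B \<times> G \<times> G)" by (auto simp: inj_on_def \<phi>_def)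
    show "\<phi> ` (B \<times> B \<times> B \<times> G \<times> G) \<subseteq> S"
      using N_G by (auto simp: \<phi>_def S_def W_def G_def power_divide power_mult_distrib)
  qed
  finally have card_S: "M ^ (9 * m) * (q - 1)\<^sup>2 \<le> card S" .
  define g where "g = (\<lambda>(P :: (nat \<Rightarrow> nat) \<times> 'a, Q :: (nat \<Rightarrow> nat) \<times> 'a, R :: (nat \<Rightarrow> nat) \<times> 'a).
    dot d (fst P) (fst Q) + dot d (fst P) (fst R) + dot d (fst Q) (fst R))"
  have dot_le: "dot d u v \<le> d * M\<^sup>2" if "u \<in> B" "v \<in> B" for u v
  proof -
    have "dot d u v \<le> (\<Sum>i<d. M * M)"
      unfolding dot_def using B_le[OF that(1)] B_le[OF that(2)] by (intro sum_mono mult_le_mono) auto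
    then show ?thesis by (simp add: power2_eq_square)
  qed
  have "g ` S \<subseteq> {..9 * m * M\<^sup>2}"
  proof (clarsimp simp: S_def g_def W_def)
    fix u v w assume "u \<in> B" "v \<in> B" "w \<in> B"
    then show "dot d u v + dot d u w + dot d v w \<le> 9 * m * M\<^sup>2"
      using dot_le[of u v] dot_le[of u w] dot_le[of v w] by (simp add: d_def)
  qed
  then obtain r where "card S \<le> card {t \<in> S. g t = r} * card {..9 * m * M\<^sup>2}"
    using ex_large_fibre[OF finS, of "{..9 * m * M\<^sup>2}" g] by auto
  then have card_fibre: "card S \<le> card {t \<in> S. g t = r} * (9 * m * M\<^sup>2 + 1)" by simp
  interpret T: norm_triple_system "\<lambda>x. x ^ q" "\<lambda>x. x ^ (q ^ 2)" \<beta> d B r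
    by (rule ns)
  define H where "H = tripartite_of W T.triple"
  have "{t \<in> S. g t = r} = {(P, Q, R) \<in> W \<times> W \<times> W. T.triple P Q R}"
    by (auto simp: S_def g_def T.triple_def T.N_def N_def)
  then have edges: "card (edges H) = card {t \<in> S. g t = r}"
    by (simp add: H_def card_edges_tripartite_of)
  have "\<not> contains_copy H (complete_tripartite 2 2 7)"
    unfolding H_def
  proof (rule tripartite_of_no_copy)
    show "T.triple Q P R" "T.triple P R Q" if "T.triple P Q R" for P Q R
      by (rule T.triple_swap[OF that])+
    fix P P' Q Q' assume "P \<in> W" "P' \<in> W" "Q \<in> W" "Q' \<in> W" "P \<noteq> P'" "Q \<noteq> Q'"
    from T.card_common_neighbours_le[OF this(1-4) _ this(5,6)]
    show "card {R \<in> W. T.triple P Q R \<and> T.triple P' Q R \<and> T.triple P Q' R \<and> T.triple P' Q' R} < 7"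
      by (force simp: W_def G_def)
  qed (simp_all add: finW)
  moreover have "three_graph H" unfolding H_def by (rule three_graph_tripartite_of[OF finW])
  moreover have "card (verts H) \<le> n"
    using n by (simp add: H_def verts_tripartite_of card_cartesian_product cardW d_def q_def)
  ultimately have "card (edges H) \<le> ex3 n (complete_tripartite 2 2 7)"
    by (intro ex3_ge verts_complete_tripartite_covered) auto
  then have "card {t \<in> S. g t = r} * (9 * m * M\<^sup>2 + 1) \<le>
      ex3 n (complete_tripartite 2 2 7) * (9 * m * M\<^sup>2 + 1)"
    unfolding edges by (rule mult_le_mono1)
  with card_S card_fibre show ?thesis unfolding q_def by linarith
qed

subsection \<open>Asymptotics\<close>

text \<open>The condition \<open>c ^ 19 < a ^ 7\<close> means that \<open>a\<close> exceeds
  \<open>c powr (19 / 7)\<close>, and the resulting exponential gap beats the linear factor.\<close>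

lemma eventually_powr_growth:
  fixes a c k :: real
  assumes c: "c > 0" and a: "a > 0" and less: "c ^ 19 < a ^ 7" and k: "k > 0"
  shows "eventually (\<lambda>m. 1 / 27 * (3 * c ^ Suc m) powr (19 / 7) * (4 * (k * real m + 1)) \<le> a ^ m) at_top"
proof -
  define b where "b = c powr (19 / 7)"
  have b: "b > 0" using c by (simp add: b_def)
  have "b = (c powr 19) powr (1 / 7)"
    by (simp add: b_def powr_powr)
  also have "c powr 19 = c ^ 19" using c by simp
  also have "(c ^ 19) powr (1 / 7) < (a ^ 7) powr (1 / 7)"
    using c less by (intro powr_less_mono2) auto
  also have "a ^ 7 = a powr 7" using a by simp
  also have "(a powr 7) powr (1 / 7) = a" using a by (simp only: powr_powr) simp
  finally have "a / b > 1" using b by simp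
  then obtain x where x: "x > 1" "x = a / b" by blast
  define K where "K = 1 / 27 * (3 * c) powr (19 / 7)"
  have K: "K > 0" using c by (simp add: K_def)
  have "eventually (\<lambda>m. K * (4 * (k * real m + 1)) \<le> x ^ m) at_top"
    using x(1) K k by real_asymp
  then show ?thesis
  proof eventually_elim
    case (elim m)
    have "(c ^ m) powr (19 / 7) = b ^ m"
    proof -
      have "(c ^ m) powr (19 / 7) = (c powr real m) powr (19 / 7)" using c by (simp add: powr_realpow)
      also have "\<dots> = b powr real m" by (simp only: b_def powr_powr mult.commute)
      also have "\<dots> = b ^ m" using b by (rule powr_realpow)
      finally show ?thesis .
    qed
    moreover have "(3 * c ^ Suc m) powr (19 / 7) = (3 * c) powr (19 / 7) * (c ^ m) powr (19 / 7)"
      using c by (subst powr_mult[symmetric]) (simp_all add: mult.assoc)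
    ultimately have "1 / 27 * (3 * c ^ Suc m) powr (19 / 7) = K * b ^ m"
      unfolding K_def by (simp only: mult.assoc)
    moreover have "K * (4 * (k * real m + 1)) * b ^ m \<le> a ^ m"
      using elim b unfolding x(2) power_divide by (simp only: pos_le_divide_eq zero_less_power)
    ultimately show ?case by (simp only: mult_ac)
  qed
qed

section \<open>The prime 797 and an algebraically closed field of that characteristic\<close>

typedef residue797 = "{..<797 :: nat}"
  by (rule exI[of _ 0]) simp

lemma card_residue797: "CARD(residue797) = 797"
  by (simp add: type_definition.card[OF type_definition_residue797])

text \<open>Trial division up to 28 suffices because 29 * 29 = 841 exceeds 797.\<close>

lemma prime_797: "prime (797 :: nat)"
  unfolding prime_nat_iff
proof (intro conjI allI impI)
  have "\<forall>m\<in>set [2..<29]. \<not> m dvd (797 :: nat)"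
    by (simp del: set_upt)
  then have "\<not> m dvd (797 :: nat)" if "2 \<le> m" "m \<le> 28" for m
    using that unfolding set_upt by auto
  then have small: "m = 1" if "m dvd 797" "m \<le> 28" for m :: nat
    using that by (cases "m = 0 \<or> m = 1") auto
  fix m :: nat assume "m dvd 797"
  then obtain k where mk: "797 = m * k" by (elim dvdE)
  then have dvd: "m dvd 797" "k dvd 797" by (metis dvd_triv_left, metis dvd_triv_right)
  have "m \<le> 28 \<or> k \<le> 28"
  proof (rule ccontr)
    assume "\<not> ?thesis"
    then have "29 * 29 \<le> m * k" by (intro mult_le_mono) auto
    with mk show False by simp
  qed
  with small[of m] small[of k] dvd have "m = 1 \<or> k = 1" by blast
  with mk show "m = 1 \<or> m = 797" by auto
qed simp

instance residue797 :: prime_card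
  by standard (simp only: card_residue797 prime_797)

text \<open>One type contains the fields with \<open>797 ^ k\<close> elements for all positive
  \<open>k\<close>, so \<open>m\<close> may grow without a change of type.\<close>

type_synonym closure797 = "residue797 mod_ring alg_closure"

lemma eventually_ex3_K227_ge:
  "eventually (\<lambda>n. 1 / 27 * real n powr (19 / 7) \<le> real (ex3 n (complete_tripartite 2 2 7))) sequentially"
proof -
  define f :: "nat \<Rightarrow> nat" where "f m = 3 * (265 ^ (3 * m) * (797 ^ m - 1))" for m
  (* 797 exceeds 3 * 265, and 797 ^ 5 < 265 ^ 6 amounts to c ^ 19 < a ^ 7: the number of
     vertices grows like c ^ m, the number of edges like a ^ m up to a factor linear in m. *)
  define c :: real where "c = 265 ^ 3 * 797"
  define a :: real where "a = 265 ^ 9 * 797\<^sup>2"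
  have "eventually (\<lambda>m. 1 / 27 * (3 * c ^ Suc m) powr (19 / 7) * (4 * (9 * 265\<^sup>2 * real m + 1)) \<le> a ^ m) at_top"
    by (rule eventually_powr_growth) (simp_all add: a_def c_def)
  then obtain m0 where m0: "\<And>m. m \<ge> m0 \<Longrightarrow>
      1 / 27 * (3 * c ^ Suc m) powr (19 / 7) * (4 * (9 * 265\<^sup>2 * real m + 1)) \<le> a ^ m"
    unfolding eventually_at_top_linorder by blast
  \<comment> \<open>For \<open>n\<close> between consecutive sizes the construction of index
    \<open>m\<close> is used. As \<open>n\<close> is below \<open>3 * c ^ Suc m\<close>, this loses
    only a constant factor.\<close>
  have bound: "1 / 27 * real n powr (19 / 7) \<le> real (ex3 n (complete_tripartite 2 2 7))"
    if m: "m \<ge> m0" "m > 0" and n: "f m \<le> n" "n < f (Suc m)" for m n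
  proof -
    let ?x = "real (ex3 n (complete_tripartite 2 2 7))"
    have "CHAR(closure797) = 797" by (simp add: card_residue797)
    from ex3_K227_ge[OF prime_797 this[symmetric] _ m(2) n(1)[unfolded f_def]]
    have "265 ^ (9 * m) * (797 ^ m - 1)\<^sup>2 \<le> ex3 n (complete_tripartite 2 2 7) * (9 * m * 265\<^sup>2 + 1)"
      by simp
    then have "real (265 ^ (9 * m) * (797 ^ m - 1)\<^sup>2) \<le>
        real (ex3 n (complete_tripartite 2 2 7) * (9 * m * 265\<^sup>2 + 1))"
      by (simp only: of_nat_le_iff)
    also have "\<dots> = ?x * (9 * 265\<^sup>2 * real m + 1)"
      by (simp only: of_nat_mult of_nat_add of_nat_power of_nat_numeral of_nat_1 mult_ac)
    finally have "real (265 ^ (9 * m) * (797 ^ m - 1)\<^sup>2) \<le> ?x * (9 * 265\<^sup>2 * real m + 1)" .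
    \<comment> \<open>The factor 4 is the square of 2 in
      \<open>797 ^ m \<le> 2 * (797 ^ m - 1)\<close>.\<close>
    moreover have "a ^ m \<le> 4 * real (265 ^ (9 * m) * (797 ^ m - 1)\<^sup>2)"
    proof -
      have "(797 :: nat) ^ m \<ge> 797 ^ 1" using m(2) by (intro power_increasing) auto
      then have "(797 :: nat) ^ m \<le> 2 * (797 ^ m - 1)" by simp
      then have "((797 :: nat) ^ m)\<^sup>2 \<le> (2 * (797 ^ m - 1))\<^sup>2" by (rule power_mono) simp
      then have "265 ^ (9 * m) * ((797 :: nat) ^ m)\<^sup>2 \<le> 265 ^ (9 * m) * (2 * (797 ^ m - 1))\<^sup>2"
        by (rule mult_le_mono2)
      then have "real (265 ^ (9 * m) * (797 ^ m)\<^sup>2) \<le> real (265 ^ (9 * m) * (2 * (797 ^ m - 1))\<^sup>2)"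
        unfolding of_nat_le_iff .
      moreover have "a ^ m = real (265 ^ (9 * m) * (797 ^ m)\<^sup>2)"
        unfolding a_def by (simp only: power_mult_distrib of_nat_mult of_nat_power of_nat_numeral flip: power_mult)
          (simp add: mult.commute)
      ultimately show ?thesis by (simp add: power_mult_distrib)
    qed
    ultimately have 1: "a ^ m \<le> 4 * (?x * (9 * 265\<^sup>2 * real m + 1))" by linarith
    have "real n \<le> real (3 * (265 ^ (3 * Suc m) * 797 ^ Suc m))"
      using n(2) unfolding f_def of_nat_le_iff
      by (elim order.trans[OF less_imp_le]) (intro mult_le_mono2, simp)
    also have "\<dots> = 3 * c ^ Suc m"
      unfolding c_def by (simp only: power_mult_distrib of_nat_mult of_nat_power of_nat_numeral flip: power_mult)
    finally have "1 / 27 * real n powr (19 / 7) \<le> 1 / 27 * (3 * c ^ Suc m) powr (19 / 7)"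
      by (intro mult_left_mono powr_mono2) auto
    then have "1 / 27 * real n powr (19 / 7) * (4 * (9 * 265\<^sup>2 * real m + 1)) \<le>
        1 / 27 * (3 * c ^ Suc m) powr (19 / 7) * (4 * (9 * 265\<^sup>2 * real m + 1))"
      by (rule mult_right_mono) simp
    also have "\<dots> \<le> ?x * (4 * (9 * 265\<^sup>2 * real m + 1))"
      using order.trans[OF m0[OF m(1)] 1] unfolding mult.left_commute[of 4 ?x] .
    finally show ?thesis by (rule mult_right_le_imp_le) (simp add: add_nonneg_pos)
  qed
  have f_ge: "m \<le> f m" for m
  proof -
    have "m < 797 ^ m" by (rule less_exp[THEN less_le_trans]) (rule power_mono, simp_all)
    then have "m \<le> 1 * (797 ^ m - 1)" by simp
    also have "\<dots> \<le> (3 * 265 ^ (3 * m)) * (797 ^ m - 1)" by (rule mult_le_mono1) simp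
    finally show ?thesis by (simp add: f_def)
  qed
  show ?thesis
    unfolding eventually_sequentially
  proof (intro exI allI impI)
    fix n assume n: "n \<ge> f (Suc m0)"
    \<comment> \<open>The maximum exists because \<open>m \<le> f m\<close>. Starting at
      \<open>f (Suc m0)\<close> ensures both \<open>m \<ge> m0\<close> and
      \<open>m > 0\<close>.\<close>
    define m where "m = (GREATEST m. f m \<le> n)"
    have bdd: "\<forall>m. f m \<le> n \<longrightarrow> m \<le> n" using f_ge le_trans by blast
    have "f m \<le> n" unfolding m_def using n bdd by (intro GreatestI_nat[of "\<lambda>m. f m \<le> n"]) auto
    moreover have "Suc m0 \<le> m" unfolding m_def using n bdd by (intro Greatest_le_nat) auto
    moreover have "n < f (Suc m)"
    proof (rule ccontr)
      assume "\<not> n < f (Suc m)"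
      then have "Suc m \<le> m" unfolding m_def using bdd by (intro Greatest_le_nat) (auto simp flip: m_def)
      then show False by simp
    qed
    ultimately show "1 / 27 * real n powr (19 / 7) \<le> real (ex3 n (complete_tripartite 2 2 7))"
      by (intro bound) auto
  qed
qed

theorem theorem1p6:
  shows "\<exists>g :: nat \<Rightarrow> real. g \<in> o(\<lambda>n. real n powr (19 / 7)) \<and>
    (\<forall>\<^sub>F n in sequentially.
       real (ex3 n (complete_tripartite 2 2 7)) \<ge> 1 / 27 * real n powr (19 / 7) + g n)"
  using eventually_ex3_K227_ge by (intro exI[of _ "\<lambda>_. 0"]) simp

end
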